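(* The time function of the Magnus breakdown algorithm on the group $G_{(1,2)} = \langle a,b \mid b^{-1}a^{-1}b\,a\,b^{-1}ab = a^2\rangle$ is not bounded by any finite tower of exponents. That is, for every deterministic realization of the Magnus breakdown algorithm on $G_{(1,2)}$ (described in the context), with time function $T:\mathbb{N}\to\mathbb{N}$, there is no fixed $k\in\mathbb{N}$ such that $T(n)\le E_k(n)$ for all $n$, where $E_0(n)=n$ and $E_{k+1}(n)=2^{E_k(n)}$.
   Context: The Magnus procedure represents $G_{(1,2)}$ as the HNN extension $\langle B_{(1,2)}, b\mid b^{-1}ab=t\rangle$ of the Baumslag-Solitar group $B_{(1,2)}=\langle a,t\mid t^{-1}at=a^2\rangle$, with stable letter $b$, and $B_{(1,2)}$ as the HNN extension $\langle \langle a\rangle, t\mid t^{-1}at=a^2\rangle$ of $\mathbb{Z}=\langle a\rangle$, with stable letter $t$. To determine whether a given word $w=w(a,b)$ represents the identity it applies Britton's lemma to these HNN extensions; this amounts to rewriting $w$ with the following infinite rewriting system $\mathcal{R}$ over the alphabet $\{a^{\pm1},b^{\pm1},t^{\pm1}\}$: $$\{t^{-1}a^kt\to a^{2k}\mid k\in\mathbb{Z}\}\cup\{ta^{2k}t^{-1}\to a^k\mid k\in\mathbb{Z}\}\cup\{b^{-1}a^kb\to t^k\mid k\in\mathbb{Z}\}\cup\{bt^kb^{-1}\to a^k\mid k\in\mathbb{Z}\}$$ $$\cup\ \{aa^{-1}\to\varepsilon,\ a^{-1}a\to\varepsilon,\ bb^{-1}\to\varepsilon,\ b^{-1}b\to\varepsilon\},$$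 where $\varepsilon$ is the empty word and powers $x^k$ stand for the corresponding literal words. An elementary rewrite is one replacement of a subword that is the left-hand side of a rule by the corresponding right-hand side. A deterministic realization of the algorithm is a deterministic choice of which rule to apply, and where, at each step; rewriting is continued until no rule applies. The time function $T(n)$ is the maximum, over all words $w$ in $a^{\pm1},b^{\pm1}$ of length at most $n$, of the number of elementary rewrites performed on input $w$. *)

theory Defs
  imports Main
begin

datatype gen = Ga | Gb | Gt

text \<open>A letter \<open>(x, True)\<close> is the generator \<open>x\<close>, and \<open>(x, False)\<close> is its formal inverse.
  Words are literal: no free reduction is built in.\<close>

type_synonym letter = "gen \<times> bool"
type_synonym word = "letter list"

definition gpow :: "gen \<Rightarrow> int \<Rightarrow> word" where
  "gpow x k = replicate (nat \<bar>k\<bar>) (x, 0 \<le> k)"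

definition magnus_rules :: "(word \<times> word) set" where
  "magnus_rules =
     {(gpow Gt (-1) @ gpow Ga k @ gpow Gt 1, gpow Ga (2 * k)) | k. True}
   \<union> {(gpow Gt 1 @ gpow Ga (2 * k) @ gpow Gt (-1), gpow Ga k) | k. True}
   \<union> {(gpow Gb (-1) @ gpow Ga k @ gpow Gb 1, gpow Gt k) | k. True}
   \<union> {(gpow Gb 1 @ gpow Gt k @ gpow Gb (-1), gpow Ga k) | k. True}
   \<union> {(gpow Ga 1 @ gpow Ga (-1), []), (gpow Ga (-1) @ gpow Ga 1, []),
      (gpow Gb 1 @ gpow Gb (-1), []), (gpow Gb (-1) @ gpow Gb 1, [])}"

text \<open>A redex \<open>(p, l, r)\<close> consists of the position \<open>p\<close> at which a rule is applied
  and the rule \<open>l \<rightarrow> r\<close> itself.\<close>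

type_synonym redex = "nat \<times> word \<times> word"

fun applicable :: "redex \<Rightarrow> word \<Rightarrow> bool" where
  "applicable (p, l, r) w \<longleftrightarrow>
     (l, r) \<in> magnus_rules \<and> (\<exists>u v. w = u @ l @ v \<and> length u = p)"

fun contract :: "redex \<Rightarrow> word \<Rightarrow> word" where
  "contract (p, l, r) w = take p w @ r @ drop (p + length l) w"

definition reducible :: "word \<Rightarrow> bool" where
  "reducible w \<longleftrightarrow> (\<exists>d. applicable d w)"

text \<open>The choice of the next redex may depend on the whole computation so far, which is passed
  as the nonempty list of words from the input to the current word. Strategies that look only
  at the current word (the last one) are a special case.\<close>

type_synonym strategy = "word list \<Rightarrow> redex"

definition realization :: "strategy \<Rightarrow> bool" where
  "realization \<sigma> \<longleftrightarrow>
     (\<forall>h. h \<noteq> [] \<and> reducible (last h) \<longrightarrow> applicable (\<sigma> h) (last h))"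

fun run :: "strategy \<Rightarrow> word \<Rightarrow> nat \<Rightarrow> word list" where
  "run \<sigma> w 0 = [w]"
| "run \<sigma> w (Suc i) =
     (let h = run \<sigma> w i in
      if reducible (last h) then h @ [contract (\<sigma> h) (last h)] else h)"

text \<open>The least element exists for every realization, see \<open>run_terminates\<close> below.\<close>

definition num_rewrites :: "strategy \<Rightarrow> word \<Rightarrow> nat" where
  "num_rewrites \<sigma> w = (LEAST i. \<not> reducible (last (run \<sigma> w i)))"

definition input_words :: "nat \<Rightarrow> word set" where
  "input_words n = {w. fst ` set w \<subseteq> {Ga, Gb} \<and> length w \<le> n}"

definition time :: "strategy \<Rightarrow> nat \<Rightarrow> nat" where
  "time \<sigma> n = Max (num_rewrites \<sigma> ` input_words n)"

fun tower :: "nat \<Rightarrow> nat \<Rightarrow> nat" where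
  "tower 0 n = n"
| "tower (Suc k) n = 2 ^ tower k n"

text \<open>The following facts show that \<open>num_rewrites\<close> and \<open>time\<close> are well defined.\<close>

definition gcount :: "gen \<Rightarrow> word \<Rightarrow> nat" where
  "gcount x w = length (filter (\<lambda>c. fst c = x) w)"

lemma gcount_simps [simp]:
  "gcount x [] = 0"
  "gcount x (u @ v) = gcount x u + gcount x v"
  "gcount x (gpow y k) = (if x = y then nat \<bar>k\<bar> else 0)"
  by (auto simp: gcount_def gpow_def)

lemma magnus_rules_decrease:
  assumes "(l, r) \<in> magnus_rules"
  shows "gcount Gb r < gcount Gb l
    \<or> gcount Gb r = gcount Gb l \<and> gcount Gt r < gcount Gt l
    \<or> gcount Gb r = gcount Gb l \<and> gcount Gt r = gcount Gt l \<and> length r < length l"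
  using assms unfolding magnus_rules_def by (auto simp: gpow_def[of Ga 1] gpow_def[of Ga "-1"])

lemma contract_decrease:
  assumes "applicable d w"
  shows "(contract d w, w) \<in> measures [gcount Gb, gcount Gt, length]"
proof -
  obtain p l r where d: "d = (p, l, r)" by (cases d)
  with assms obtain u v where "(l, r) \<in> magnus_rules" "w = u @ l @ v" "length u = p"
    by auto
  with magnus_rules_decrease[of l r] show ?thesis by (auto simp: d)
qed

lemma run_nonempty [simp]: "run \<sigma> w i \<noteq> []"
  by (induction i) (auto simp: Let_def)

lemma run_terminates:
  assumes "realization \<sigma>"
  shows "\<exists>i. \<not> reducible (last (run \<sigma> w i))"
proof (rule ccontr)
  assume "\<not> ?thesis"
  then have red: "reducible (last (run \<sigma> w i))" for i by blast
  have "\<forall>i. (last (run \<sigma> w (Suc i)), last (run \<sigma> w i))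
    \<in> measures [gcount Gb, gcount Gt, length]"
  proof
    fix i
    show "(last (run \<sigma> w (Suc i)), last (run \<sigma> w i))
      \<in> measures [gcount Gb, gcount Gt, length]"
      using assms red[of i] contract_decrease[of "\<sigma> (run \<sigma> w i)" "last (run \<sigma> w i)"]
      unfolding realization_def by (simp add: Let_def del: in_measures)
  qed
  then have "\<exists>f. \<forall>i. (f (Suc i), f i) \<in> measures [gcount Gb, gcount Gt, length]"
    by (rule exI[where x = "\<lambda>i. last (run \<sigma> w i)"])
  then show False
    using wf_measures[of "[gcount Gb, gcount Gt, length]"]
    unfolding wf_iff_no_infinite_down_chain by blast
qed

lemma finite_input_words: "finite (input_words n)"
proof -
  have "input_words n \<subseteq> {w. set w \<subseteq> {Ga, Gb} \<times> UNIV \<and> length w \<le> n}"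
    by (auto simp: input_words_def)
  moreover have "finite {w :: word. set w \<subseteq> {Ga, Gb} \<times> UNIV \<and> length w \<le> n}"
    by (rule finite_lists_length_le) auto
  ultimately show ?thesis by (rule finite_subset)
qed

lemma input_words_nonempty: "input_words n \<noteq> {}"
  by (auto simp: input_words_def intro: exI[of _ "[]"])

end

theory Submission
  imports Defs
begin

text \<open>Put \<open>w\<^sub>0 = a\<close> and let \<open>w\<^sub>n\<^sub>+\<^sub>1\<close> be the conjugate of \<open>a\<close> by \<open>b\<^sup>-\<^sup>1 w\<^sub>n b\<close>. Then \<open>w\<^sub>n\<close> has
  length at most \<open>2\<^sup>n\<^sup>+\<^sup>3\<close> and represents \<open>a\<^sup>N\<close> with \<open>N\<close> a tower of \<open>n\<close> twos. The \<open>b\<close>-letters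
  separate the parts of these words so strictly that every maximal rewriting sequence from \<open>w\<^sub>n\<close> ends
  in the literal word \<open>a\<^sup>N\<close>, whatever the strategy. As a single rewrite at most doubles the length,
  at least \<open>log\<^sub>2 N - n - 3\<close> rewrites are performed.\<close>

section \<open>Elementary rewrites\<close>

definition step :: "word \<Rightarrow> word \<Rightarrow> bool" where
  "step w w' \<longleftrightarrow> (\<exists>u l r v. (l, r) \<in> magnus_rules \<and> w = u @ l @ v \<and> w' = u @ r @ v)"

lemma reducible_iff_step: "reducible w \<longleftrightarrow> (\<exists>w'. step w w')"
  unfolding reducible_def step_def by fastforce

lemma step_contract: "applicable d w \<Longrightarrow> step w (contract d w)"
  by (cases d) (fastforce simp: step_def)

lemma step_rule: "(l, r) \<in> magnus_rules \<Longrightarrow> step (u @ l @ v) (u @ r @ v)"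
  unfolding step_def by blast

lemma step_append_context: "step w w' \<Longrightarrow> step (u @ w @ v) (u @ w' @ v)"
  unfolding step_def by (metis append.assoc)

lemma length_gpow [simp]: "length (gpow x k) = nat \<bar>k\<bar>"
  by (simp add: gpow_def)

lemma gpow_eq_Nil_iff [simp]: "gpow x k = [] \<longleftrightarrow> k = 0"
  by (auto simp: gpow_def)

lemma gpow_0 [simp]: "gpow x 0 = []"
  by (simp add: gpow_def)

lemma set_gpow: "set (gpow x k) = (if k = 0 then {} else {(x, 0 < k)})"
  by (auto simp: gpow_def)

lemma gpow_one: "gpow x 1 = [(x, True)]" "gpow x (-1) = [(x, False)]"
  by (simp_all add: gpow_def)

lemma gpow_eq_iff [simp]: "gpow x k = gpow x m \<longleftrightarrow> k = m"
proof
  assume eq: "gpow x k = gpow x m"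
  then have "\<bar>k\<bar> = \<bar>m\<bar>" by (metis length_gpow eq_nat_nat_iff abs_ge_zero)
  moreover have "(0 < k) = (0 < m)" if "k \<noteq> 0" "m \<noteq> 0"
    using arg_cong[OF eq, of set] that by (auto simp: set_gpow)
  ultimately show "k = m" by (cases "k = 0"; cases "m = 0"; auto simp: abs_if split: if_splits)
qed simp

text \<open>To locate a redex only its frame matters: two mutually inverse letters with nothing of
  their generator in between. Free cancellations are frames around an empty middle.\<close>

lemma magnus_rules_shape:
  assumes "(l, r) \<in> magnus_rules"
  obtains x d g where "l = (x, d) # g @ [(x, \<not> d)]" "x \<notin> fst ` set g"
proof -
  consider k where "l = gpow Gt (-1) @ gpow Ga k @ gpow Gt 1"
    | k where "l = gpow Gt 1 @ gpow Ga k @ gpow Gt (-1)"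
    | k where "l = gpow Gb (-1) @ gpow Ga k @ gpow Gb 1"
    | k where "l = gpow Gb 1 @ gpow Gt k @ gpow Gb (-1)"
    | x where "l = gpow x 1 @ gpow x (-1)" | x where "l = gpow x (-1) @ gpow x 1"
    using assms unfolding magnus_rules_def by blast
  then obtain x d y k where "l = (x, d) # gpow y k @ [(x, \<not> d)]" "y \<noteq> x \<or> k = 0"
  proof cases
    case (1 k) then show thesis using that[of Gt False Ga k] by (simp add: gpow_one)
  next
    case (2 k) then show thesis using that[of Gt True Ga k] by (simp add: gpow_one)
  next
    case (3 k) then show thesis using that[of Gb False Ga k] by (simp add: gpow_one)
  next
    case (4 k) then show thesis using that[of Gb True Gt k] by (simp add: gpow_one)
  next
    case (5 x) then show thesis using that[of x True x 0] by (simp add: gpow_one)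
  next
    case (6 x) then show thesis using that[of x False x 0] by (simp add: gpow_one)
  qed
  then show thesis by (intro that[of x d "gpow y k"]) (auto simp: set_gpow split: if_splits)
qed

text \<open>Serves as an irreducibility test: a word in which no generator occurs with both signs
  admits no rewrite.\<close>

lemma step_inverse_letters:
  assumes "step w w'"
  obtains x where "(x, True) \<in> set w" "(x, False) \<in> set w"
proof -
  obtain u l r v where "(l, r) \<in> magnus_rules" "w = u @ l @ v"
    using assms unfolding step_def by blast
  with magnus_rules_shape[of l r] obtain x d where "(x, d) \<in> set w" "(x, \<not> d) \<in> set w"
    by (metis Un_iff list.set_intros(1) set_append set_ConsD list.set_intros(2))
  then show thesis using that by (cases d) auto
qed

text \<open>Only the rules t^-1 a^k t -> a^(2k) can lengthen a word, and they replace |k| + 2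
  letters by 2|k|.\<close>

lemma length_step:
  assumes "step w w'"
  shows "length w' \<le> 2 * length w"
proof -
  obtain u l r v where "(l, r) \<in> magnus_rules" "w = u @ l @ v" "w' = u @ r @ v"
    using assms unfolding step_def by blast
  moreover from this(1) have "length r \<le> 2 * length l"
    unfolding magnus_rules_def by (auto simp: abs_mult)
  ultimately show ?thesis by simp
qed

text \<open>Pairs of letters (not all of them) that are never adjacent in a left-hand side.\<close>

definition barrier :: "letter \<Rightarrow> letter \<Rightarrow> bool" where
  "barrier x y \<longleftrightarrow> fst x = Gb \<and> x = y
     \<or> x = (Gb, True) \<and> fst y = Ga \<or> fst x = Ga \<and> y = (Gb, False)
     \<or> x = (Gb, False) \<and> fst y = Gt \<or> fst x = Gt \<and> y = (Gb, True)"

lemma successively_gpow: "(\<And>d. P (x, d) (x, d)) \<Longrightarrow> successively P (gpow x k)"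
  unfolding gpow_def by (auto simp: successively_conv_nth)

lemma hd_last_gpow: "k \<noteq> 0 \<Longrightarrow> hd (gpow x k) = (x, 0 \<le> k) \<and> last (gpow x k) = (x, 0 \<le> k)"
  by (auto simp: gpow_def)

text \<open>When b-letters frame a block of a's in a left-hand side, b^-1 is on the left and b on
  the right; for a block of t's it is the reverse. \<open>barrier\<close> collects the opposite
  orientations and the repeated b-letters.\<close>

lemma successively_lhs:
  assumes "(l, r) \<in> magnus_rules"
  shows "successively (\<lambda>x y. \<not> barrier x y) l"
proof -
  have "successively (\<lambda>x y. \<not> barrier x y) ((x, d) # gpow y k @ [(x, \<not> d)])"
    if "(x, d, y) \<in> {(Gt, False, Ga), (Gt, True, Ga), (Gb, False, Ga), (Gb, True, Gt)}" for x d y k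
    using that
    by (cases "k = 0") (auto simp: successively_Cons successively_append_iff barrier_def
        hd_append hd_last_gpow intro!: successively_gpow)
  from this[of Gt False Ga] this[of Gt True Ga] this[of Gb False Ga] this[of Gb True Gt]
  show ?thesis using assms unfolding magnus_rules_def
    by (auto simp: gpow_one barrier_def)
qed

text \<open>No redex can straddle a barrier, so the two sides are rewritten independently of each
  other.\<close>

lemma step_append:
  assumes "step (U @ V) w'" "U \<noteq> []" "V \<noteq> []" "barrier (last U) (hd V)"
  obtains U' where "step U U'" "w' = U' @ V"
    | V' where "step V V'" "w' = U @ V'"
proof -
  obtain u l r v where lr: "(l, r) \<in> magnus_rules" and w: "U @ V = u @ l @ v" "w' = u @ r @ v"
    using assms(1) unfolding step_def by blast
  have "l \<noteq> []" using lr by (elim magnus_rules_shape) auto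
  from w(1) consider s where "U = u @ s" "s @ V = l @ v" | s where "U @ s = u" "V = s @ l @ v"
    by (auto simp: append_eq_append_conv2)
  then show thesis
  proof cases
    case 1
    from 1(2) consider s' where "s = l @ s'" "s' @ V = v" | s' where "l = s @ s'" "V = s' @ v"
      by (auto simp: append_eq_append_conv2)
    then show thesis
    proof cases
      case 1
      with \<open>U = u @ s\<close> w lr that(1)[of "u @ r @ s'"] show thesis by (auto simp: step_def)
    next
      case 2
      \<comment> \<open>If both were nonempty, the letters \<open>last U\<close> and
        \<open>hd V\<close> would be adjacent inside \<open>l\<close>.\<close>
      have "s = [] \<or> s' = []"
        using successively_lhs[OF lr] assms(4) 2 \<open>U = u @ s\<close>
        by (cases "s = []"; cases "s' = []") (auto simp: successively_append_iff)
      then show thesis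
      proof
        assume "s = []"
        with 2 1 w lr that(2)[of "r @ v"] show thesis unfolding step_def
          by (metis append_Nil append_Nil2)
      next
        assume "s' = []"
        with 2 1 w lr that(1)[of "u @ r"] show thesis unfolding step_def
          by (metis append.assoc append_Nil append_Nil2)
      qed
    qed
  next
    case 2
    with w lr that(2)[of "s @ r @ v"] show thesis by (auto simp: step_def)
  qed
qed

section \<open>Redexes in a word x^-i a^m x^i\<close>

lemma replicate_blocks_factor:
  assumes "replicate i y @ replicate n c @ replicate j z = u @ y # g @ z # v"
    and "distinct [y, c, z]" "y \<notin> set g" "z \<notin> set g"
  obtains p q where "i = Suc p" "j = Suc q" "u = replicate p y" "g = replicate n c"
    "v = replicate q z"
proof -
  let ?w = "u @ y # g @ z # v"
  \<comment> \<open>Ranking the letters in the order of the blocks makes the word sorted, so only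
    \<open>y\<close> can precede a \<open>y\<close> and only \<open>z\<close> can follow a
    \<open>z\<close>. Counting letters then recovers the block lengths.\<close>
  define f :: "'a \<Rightarrow> nat" where "f x = (if x = y then 0 else if x = z then 2 else 1)" for x
  have f: "f y = 0" "f c = 1" "f z = 2" using assms(2) by (auto simp: f_def)
  have "sorted (map f (replicate i y @ replicate n c @ replicate j z))"
    by (auto simp: sorted_append f)
  then have srt: "sorted (map f ?w)" by (simp only: assms(1))
  have sub: "set ?w \<subseteq> {y, c, z}" unfolding assms(1)[symmetric] by auto
  have "f x \<le> f y" if "x \<in> set u" for x
    using srt that by (simp add: sorted_append)
  then have "x = y" if "x \<in> set u" for x
    using that by (force simp: f_def split: if_splits)
  then have u: "u = replicate (length u) y" by (intro replicate_eqI) auto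
  have "f z \<le> f x" if "x \<in> set v" for x
    using srt that by (simp add: sorted_append)
  then have "x = z" if "x \<in> set v" for x
    using that f(3) by (force simp: f_def split: if_splits)
  then have v: "v = replicate (length v) z" by (intro replicate_eqI) auto
  have g: "g = replicate (length g) c"
    using sub assms(3,4) by (intro replicate_eqI) auto
  have count: "count_list (replicate m x) x' = (if x = x' then m else 0)" for m and x x' :: 'a
    by (induction m) auto
  have cnt: "count_list (replicate i y @ replicate n c @ replicate j z) x = count_list
    (replicate (length u) y @ y # replicate (length g) c @ z # replicate (length v) z) x" for x
    by (simp only: u[symmetric] v[symmetric] g[symmetric] assms(1))
  from cnt[of y] cnt[of c] cnt[of z] have "i = Suc (length u)" "n = length g" "j = Suc (length v)"
    using assms(2) by (auto simp: count)
  with u v g show thesis by (intro that[of "length u" "length v"]) (simp_all only:)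
qed

lemma replicate_blocks_no_descent:
  assumes "replicate i y @ replicate n c @ replicate j z = u @ z # g @ y # v"
    and "distinct [y, c, z]"
  shows False
proof -
  define f :: "'a \<Rightarrow> nat" where "f x = (if x = y then 0 else if x = z then 2 else 1)" for x
  have f: "f y = 0" "f c = 1" "f z = 2" using assms(2) by (auto simp: f_def)
  have "sorted (map f (replicate i y @ replicate n c @ replicate j z))"
    by (auto simp: sorted_append f)
  then have "sorted (map f (u @ z # g @ y # v))" by (simp only: assms(1))
  then show False by (simp add: sorted_append f)
qed

text \<open>The block of a's has a single sign, so the frame of a redex consists of x-letters;
  containing no further x-letter, it must be the innermost pair. Hence rewriting here is
  deterministic up to the choice of \<open>r\<close>.\<close>

lemma step_conjugate:
  assumes "step (gpow x (- int i) @ gpow Ga m @ gpow x (int i)) w'" "x \<noteq> Ga" "m \<noteq> 0"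
  obtains p r where "i = Suc p" "w' = gpow x (- int p) @ r @ gpow x (int p)"
    "(gpow x (-1) @ gpow Ga m @ gpow x 1, r) \<in> magnus_rules"
proof -
  let ?w = "gpow x (- int i) @ gpow Ga m @ gpow x (int i)"
  obtain u l r v where lr: "(l, r) \<in> magnus_rules" and w: "?w = u @ l @ v" "w' = u @ r @ v"
    using assms(1) unfolding step_def by blast
  obtain x' d g where l: "l = (x', d) # g @ [(x', \<not> d)]" "x' \<notin> fst ` set g"
    using lr by (elim magnus_rules_shape)
  have "(x', d) \<in> set ?w" "(x', \<not> d) \<in> set ?w" unfolding w(1) l by auto
  then have x': "x' = x" and "i > 0" using assms(2) by (auto simp: set_gpow split: if_splits)
  have gp: "gpow x (- int k) = replicate k (x, False)" "gpow x (int k) = replicate k (x, True)" for k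
    by (cases "k = 0"; simp add: gpow_def)+
  have blocks: "?w = replicate i (x, False) @ replicate (nat \<bar>m\<bar>) (Ga, 0 \<le> m) @ replicate i (x, True)"
    by (simp only: gp gpow_def[of Ga])
  have dist: "distinct [(x, False), (Ga, 0 \<le> m), (x, True)]" using assms(2) by auto
  \<comment> \<open>A frame opening with x would need an x^-1 further right, but all x^-1 come
    first.\<close>
  have "\<not> d"
    using replicate_blocks_no_descent[OF _ dist, of i "nat \<bar>m\<bar>" i u g v] w(1) l(1) x' blocks
    by auto
  then have "replicate i (x, False) @ replicate (nat \<bar>m\<bar>) (Ga, 0 \<le> m) @ replicate i (x, True)
      = u @ (x, False) # g @ (x, True) # v"
    using w(1) l(1) x' blocks by auto
  then obtain p q where pq: "i = Suc p" "i = Suc q" "u = replicate p (x, False)"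
    "g = replicate (nat \<bar>m\<bar>) (Ga, 0 \<le> m)" "v = replicate q (x, True)"
    by (rule replicate_blocks_factor[OF _ dist]) (use l(2) x' in \<open>auto simp: image_iff\<close>)
  then have "l = gpow x (-1) @ gpow Ga m @ gpow x 1"
    using l(1) \<open>\<not> d\<close> x' by (simp add: gpow_one gpow_def[of Ga])
  with pq w lr show thesis by (intro that[of p r]) (auto simp: gp)
qed

lemma conjugate_t_rule:
  assumes "(gpow Gt (-1) @ gpow Ga m @ gpow Gt 1, r) \<in> magnus_rules"
  shows "r = gpow Ga (2 * m)"
  using assms unfolding magnus_rules_def by (auto simp: gpow_one)

lemma conjugate_b_rule:
  assumes "(gpow Gb (-1) @ gpow Ga m @ gpow Gb 1, r) \<in> magnus_rules" "m \<noteq> 0"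
  shows "r = gpow Gt m"
  using assms unfolding magnus_rules_def by (auto simp: gpow_one)

section \<open>Short words for tall towers\<close>

text \<open>The parameter \<open>e\<close> replaces formal inversion: the inverse of a conjugate of
  a is the conjugate of a^-1 by the same element.\<close>

fun tower_word :: "nat \<Rightarrow> int \<Rightarrow> word" where
  "tower_word 0 e = gpow Ga e"
| "tower_word (Suc n) e =
     (gpow Gb (-1) @ tower_word n (-1) @ gpow Gb 1) @ gpow Ga e
     @ (gpow Gb (-1) @ tower_word n 1 @ gpow Gb 1)"

text \<open>The states of a flank b^-1 w b: either rewriting still goes on inside, or the b-letters
  have been consumed and t^m is left.\<close>

definition b_conjugates :: "int \<Rightarrow> word set \<Rightarrow> word set" where
  "b_conjugates m S = insert (gpow Gt m) ((\<lambda>X. gpow Gb (-1) @ X @ gpow Gb 1) ` S)"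

text \<open>Contains every word that can be reached from \<open>tower_word n e\<close>.\<close>

fun reducts :: "nat \<Rightarrow> int \<Rightarrow> word set" where
  "reducts 0 e = {gpow Ga e}"
| "reducts (Suc n) e =
     {L @ gpow Ga e @ R | L R.
        L \<in> b_conjugates (- int (tower n 1)) (reducts n (-1)) \<and>
        R \<in> b_conjugates (int (tower n 1)) (reducts n 1)}
     \<union> {gpow Gt (- int i) @ gpow Ga (e * 2 ^ j) @ gpow Gt (int i) | i j. i + j = tower n 1}"

lemma tower_pos: "0 < n \<Longrightarrow> 0 < tower k n"
  by (cases k) auto

lemma tower_word_in_reducts: "tower_word n e \<in> reducts n e"
proof (induction n arbitrary: e)
  case (Suc n)
  then show ?case unfolding tower_word.simps reducts.simps b_conjugates_def by blast
qed simp

text \<open>Solves the recursion l(n+1) = 2 l(n) + 5 with l(0) = 1.\<close>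

lemma length_tower_word: "\<bar>e\<bar> = 1 \<Longrightarrow> length (tower_word n e) + 5 = 6 * 2 ^ n"
proof (induction n arbitrary: e)
  case (Suc n)
  from Suc.IH[of 1] Suc.IH[of "-1"] Suc.prems show ?case by simp
qed simp

lemma length_tower_word_Suc_le: "length (tower_word (Suc n) 1) \<le> 2 ^ (n + 4)"
  using length_tower_word[of 1 "Suc n"] by (simp add: power_add)

lemma tower_word_letters: "fst ` set (tower_word n e) \<subseteq> {Ga, Gb}"
  by (induction n arbitrary: e) (auto simp: set_gpow)

section \<open>Words reachable from the tower words\<close>

text \<open>An unfinished reduct has end letters that form barriers with a surrounding b^-1 and b.
  The outer b-letters can therefore take part in a rewrite only after the inside has become a power
  of a.\<close>

lemma reducts_shape:
  assumes "X \<in> reducts n e"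
  shows "X = gpow Ga (e * int (tower n 1)) \<or>
    X \<noteq> [] \<and> hd X \<in> {(Gb, False), (Gt, False)} \<and> last X \<in> {(Gb, True), (Gt, True)}"
proof (cases n)
  case (Suc k)
  have pos: "0 < tower k 1" by (simp add: tower_pos)
  have "X \<noteq> [] \<and> hd X \<in> {(Gb, False), (Gt, False)} \<and> last X \<in> {(Gb, True), (Gt, True)}"
    if "X = L @ gpow Ga e @ R" "L \<in> b_conjugates (- int (tower k 1)) (reducts k (-1))"
      "R \<in> b_conjugates (int (tower k 1)) (reducts k 1)" for L R
    using that pos by (auto simp: b_conjugates_def gpow_one hd_append last_append hd_last_gpow)
  moreover have "X = gpow Ga (e * int (tower n 1)) \<or>
    X \<noteq> [] \<and> hd X = (Gt, False) \<and> last X = (Gt, True)"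
    if "X = gpow Gt (- int i) @ gpow Ga (e * 2 ^ j) @ gpow Gt (int i)" "i + j = tower k 1" for i j
    using that Suc by (cases "i = 0") (auto simp: hd_append last_append hd_last_gpow)
  ultimately show ?thesis using assms Suc by auto
qed (use assms in simp)

text \<open>The last hypothesis is the induction hypothesis of \<open>reducts_closed\<close>;
  \<open>d\<close> is the sign of the flank.\<close>

lemma b_conjugates_closed:
  assumes "step W W'" "W \<in> b_conjugates (d * int (tower n 1)) (reducts n d)" "d \<noteq> 0"
    and "\<And>X X'. X \<in> reducts n d \<Longrightarrow> step X X' \<Longrightarrow> X' \<in> reducts n d"
  shows "W' \<in> b_conjugates (d * int (tower n 1)) (reducts n d)"
proof -
  let ?m = "d * int (tower n 1)"
  have m: "?m \<noteq> 0" using assms(3) tower_pos[of 1 n] by simp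
  have irred: "\<not> step (gpow x k) V" for x k V
    by (auto simp: set_gpow elim!: step_inverse_letters split: if_splits)
  then obtain X where X: "X \<in> reducts n d" "W = gpow Gb (-1) @ X @ gpow Gb 1"
    using assms(1,2) by (auto simp: b_conjugates_def)
  from reducts_shape[OF X(1)] show ?thesis
  proof
    assume "X = gpow Ga ?m"
    then have "step (gpow Gb (- int 1) @ gpow Ga ?m @ gpow Gb (int 1)) W'"
      using assms(1) X(2) by simp
    then obtain r where "W' = r" "(gpow Gb (-1) @ gpow Ga ?m @ gpow Gb 1, r) \<in> magnus_rules"
      by (rule step_conjugate) (use m in auto)
    with conjugate_b_rule m show ?thesis by (auto simp: b_conjugates_def)
  next
    assume sh: "X \<noteq> [] \<and> hd X \<in> {(Gb, False), (Gt, False)} \<and> last X \<in> {(Gb, True), (Gt, True)}"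
    have "barrier (last (gpow Gb (-1))) (hd (X @ gpow Gb 1))" "barrier (last X) (hd (gpow Gb 1))"
      using sh by (auto simp: gpow_one barrier_def)
    with sh obtain X' where "step X X'" "W' = gpow Gb (-1) @ X' @ gpow Gb 1"
      using assms(1) unfolding X(2) by (auto elim!: step_append simp: irred)
    with assms(4) X(1) show ?thesis by (auto simp: b_conjugates_def)
  qed
qed

text \<open>As long as a flank keeps its b-letters, the middle a^e is separated from it by a
  barrier. Only when both flanks are powers of t does the middle react, by one t-rule after
  another.\<close>

lemma reducts_closed:
  assumes "step X X'" "X \<in> reducts n e" "e \<noteq> 0"
  shows "X' \<in> reducts n e"
  using assms
proof (induction n arbitrary: X X' e)
  case 0
  then show ?case by (auto simp: set_gpow elim!: step_inverse_letters split: if_splits)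
next
  case (Suc n)
  let ?E = "tower n 1"
  let ?L = "b_conjugates (- int ?E) (reducts n (-1))"
  let ?R = "b_conjugates (int ?E) (reducts n 1)"
  have L: "W' \<in> ?L" if "step W W'" "W \<in> ?L" for W W'
    using b_conjugates_closed[of W W' "-1" n] that Suc.IH[where e = "-1"] by auto
  have R: "W' \<in> ?R" if "step W W'" "W \<in> ?R" for W W'
    using b_conjugates_closed[of W W' 1 n] that Suc.IH[where e = 1] by auto
  have tower_case: "X' \<in> reducts (Suc n) e"
    if "X = gpow Gt (- int i) @ gpow Ga (e * 2 ^ j) @ gpow Gt (int i)" "i + j = ?E" for i j
  proof -
    have "e * 2 ^ j \<noteq> 0" using Suc.prems(3) by simp
    with Suc.prems(1) that(1) obtain p r where
      "i = Suc p" "X' = gpow Gt (- int p) @ r @ gpow Gt (int p)"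
      "(gpow Gt (-1) @ gpow Ga (e * 2 ^ j) @ gpow Gt 1, r) \<in> magnus_rules"
      by (auto elim: step_conjugate)
    moreover from this(3) have "r = gpow Ga (e * 2 ^ Suc j)"
      using conjugate_t_rule by (fastforce simp: mult.left_commute)
    \<comment> \<open>A t-rule uses up one pair of t-letters and doubles the exponent once, which
      keeps \<open>i + j\<close> fixed.\<close>
    moreover have "p + Suc j = ?E" using that(2) \<open>i = Suc p\<close> by simp
    ultimately show ?thesis unfolding reducts.simps by blast
  qed
  have node_case: "X' \<in> reducts (Suc n) e"
    if X: "X = A @ gpow Ga e @ B" "A \<in> ?L" "B \<in> ?R" for A B
  proof -
    have node: "A' @ gpow Ga e @ B' \<in> reducts (Suc n) e" if "A' \<in> ?L" "B' \<in> ?R" for A' B'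
      using that unfolding reducts.simps by blast
    have e: "e \<noteq> 0" by fact
    have irred: "\<not> step (gpow Gt k @ gpow Ga e) V" "\<not> step (gpow Ga e @ gpow Gt k) V"
      "\<not> step (gpow Ga e) V" for k V
      by (auto simp: set_gpow elim!: step_inverse_letters split: if_splits)
    have A: "A = gpow Gt (- int ?E) \<or> A \<noteq> [] \<and> last A = (Gb, True)"
      using X(2) by (auto simp: b_conjugates_def gpow_one)
    have B: "B = gpow Gt (int ?E) \<or> B \<noteq> [] \<and> hd B = (Gb, False)"
      using X(3) by (auto simp: b_conjugates_def gpow_one)
    have rew: "step (A @ gpow Ga e @ B) X'" using Suc.prems(1) X(1) by simp
    \<comment> \<open>The first case enters the t-phase with \<open>i = ?E\<close> and
      \<open>j = 0\<close>. In the others, \<open>e \<noteq> 0\<close> provides an a-letter that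
      forms a barrier with a b-letter of a flank.\<close>
    consider "A = gpow Gt (- int ?E)" "B = gpow Gt (int ?E)"
      | "A = gpow Gt (- int ?E)" "B \<noteq> []" "hd B = (Gb, False)"
      | "A \<noteq> []" "last A = (Gb, True)"
      using A B by blast
    then show ?thesis
    proof cases
      case 1
      then show ?thesis using tower_case[of ?E 0] X(1) by simp
    next
      case 2
      have "step ((A @ gpow Ga e) @ B) X'" using rew by simp
      then show ?thesis
      proof (rule step_append)
        show "barrier (last (A @ gpow Ga e)) (hd B)" using 2 e by (simp add: hd_last_gpow barrier_def)
      next
        fix U' assume "step (A @ gpow Ga e) U'"
        with 2(1) irred(1) show ?thesis by simp
      next
        fix V' assume "step B V'" "X' = (A @ gpow Ga e) @ V'"
        with node[OF X(2) R[OF _ X(3)]] show ?thesis by simp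
      qed (use 2 e in simp_all)
    next
      case 3
      show ?thesis using rew
      proof (rule step_append)
        show "barrier (last A) (hd (gpow Ga e @ B))" using 3 e by (simp add: hd_last_gpow barrier_def)
      next
        fix V' assume V': "step (gpow Ga e @ B) V'" "X' = A @ V'"
        with B irred(2) have B': "B \<noteq> []" "hd B = (Gb, False)" by metis+
        show ?thesis using V'(1)
        proof (rule step_append)
          show "barrier (last (gpow Ga e)) (hd B)" using B' e by (simp add: hd_last_gpow barrier_def)
        next
          fix U' assume "step (gpow Ga e) U'"
          with irred(3) show ?thesis by simp
        next
          fix V'' assume "step B V''" "V' = gpow Ga e @ V''"
          with node[OF X(2) R[OF _ X(3)]] V'(2) show ?thesis by simp
        qed (use B' e in simp_all)
      next
        fix U' assume "step A U'" "X' = U' @ gpow Ga e @ B"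
        with node[OF L[OF _ X(2)] X(3)] show ?thesis by simp
      qed (use 3 e in simp_all)
    qed
  qed
  from Suc.prems(2)[unfolded reducts.simps(2)] show ?case
  proof (elim UnE CollectE exE conjE)
    fix A B assume "X = A @ gpow Ga e @ B" "A \<in> ?L" "B \<in> ?R"
    then show ?thesis by (rule node_case)
  next
    fix i j assume "X = gpow Gt (- int i) @ gpow Ga (e * 2 ^ j) @ gpow Gt (int i)" "i + j = ?E"
    then show ?thesis by (rule tower_case)
  qed
qed

text \<open>Every other reduct contains a redex: inside a flank, at the b-letters of a flank whose
  inside is finished, or at the innermost t-letters. This makes the final word independent of the
  strategy.\<close>

lemma irreducible_reduct:
  assumes "X \<in> reducts n e" "\<not> reducible X"
  shows "X = gpow Ga (e * int (tower n 1))"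
  using assms
proof (induction n arbitrary: X e)
  case (Suc n)
  let ?E = "tower n 1"
  have irred: "\<not> step X W" for W using Suc.prems(2) by (simp add: reducible_iff_step)
  have t_rule: "i = 0" if "X = gpow Gt (- int i) @ gpow Ga m @ gpow Gt (int i)" for i m
  proof (rule ccontr)
    assume "i \<noteq> 0"
    then obtain p where p: "i = Suc p" by (cases i) auto
    have "gpow Gt (- int i) = gpow Gt (- int p) @ gpow Gt (-1)"
      "gpow Gt (int i) = gpow Gt 1 @ gpow Gt (int p)"
      by (simp_all add: p gpow_def nat_add_distrib flip: replicate_append_same)
    then have "X = gpow Gt (- int p) @ (gpow Gt (-1) @ gpow Ga m @ gpow Gt 1) @ gpow Gt (int p)"
      using that by simp
    moreover have "(gpow Gt (-1) @ gpow Ga m @ gpow Gt 1, gpow Ga (2 * m)) \<in> magnus_rules"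
      unfolding magnus_rules_def by blast
    ultimately show False using irred step_rule by metis
  qed
  have side: "W = gpow Gt (d * int ?E)"
    if "W \<in> b_conjugates (d * int ?E) (reducts n d)" "X = U @ W @ V" for U V W d
  proof (rule ccontr)
    assume "W \<noteq> gpow Gt (d * int ?E)"
    with that obtain Y where Y: "Y \<in> reducts n d" "W = gpow Gb (-1) @ Y @ gpow Gb 1"
      by (auto simp: b_conjugates_def)
    have "\<not> reducible Y"
      using irred that(2) Y(2) step_append_context[of Y _ "U @ gpow Gb (-1)" "gpow Gb 1 @ V"]
      by (auto simp: reducible_iff_step)
    with Suc.IH Y have "W = gpow Gb (-1) @ gpow Ga (d * int ?E) @ gpow Gb 1" by blast
    moreover have "(gpow Gb (-1) @ gpow Ga m @ gpow Gb 1, gpow Gt m) \<in> magnus_rules" for m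
      unfolding magnus_rules_def by blast
    ultimately show False using irred that(2) step_rule by metis
  qed
  consider (node) A B where "X = A @ gpow Ga e @ B"
      "A \<in> b_conjugates (- int ?E) (reducts n (-1))" "B \<in> b_conjugates (int ?E) (reducts n 1)"
    | (tower) i j where "X = gpow Gt (- int i) @ gpow Ga (e * 2 ^ j) @ gpow Gt (int i)" "i + j = ?E"
    using Suc.prems(1) by auto
  then show ?case
  proof cases
    case node
    have "A = gpow Gt (- int ?E)" using side[of A "-1" "[]"] node by simp
    moreover have "B = gpow Gt (int ?E)" using side[of B 1 "A @ gpow Ga e" "[]"] node by simp
    \<comment> \<open>With both flanks finished, the word is t^-E a^e t^E, which is irreducible only
      for E = 0.\<close>
    ultimately have "?E = 0" using t_rule node(1) by blast
    then show ?thesis using tower_pos[of 1 n] by simp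
  next
    case tower
    with t_rule[OF tower(1)] show ?thesis by simp
  qed
qed simp

section \<open>The lower bound\<close>

text \<open>Both invariants are preserved by any single rewrite, so it is immaterial that the
  strategy may look at the history.\<close>

lemma run_tower_word:
  assumes "realization \<sigma>"
  shows "last (run \<sigma> (tower_word n 1) i) \<in> reducts n 1 \<and>
    length (last (run \<sigma> (tower_word n 1) i)) \<le> 2 ^ i * length (tower_word n 1)"
proof (induction i)
  case 0
  show ?case by (simp add: tower_word_in_reducts)
next
  case (Suc i)
  let ?h = "run \<sigma> (tower_word n 1) i"
  show ?case
  proof (cases "reducible (last ?h)")
    case True
    then have "step (last ?h) (contract (\<sigma> ?h) (last ?h))"
      using assms by (intro step_contract) (simp add: realization_def)
    with reducts_closed[OF this] length_step[OF this] Suc True show ?thesis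
      by (simp add: Let_def)
  next
    case False
    with Suc show ?thesis by (simp add: Let_def)
  qed
qed

text \<open>The final word has length \<open>2 ^ tower n 1\<close> and arises by that many rewrites,
  each at most doubling, from length at most \<open>2 ^ (n + 4)\<close>; compare the exponents of
  2.\<close>

lemma num_rewrites_tower_word:
  assumes "realization \<sigma>"
  shows "tower n 1 \<le> num_rewrites \<sigma> (tower_word (Suc n) 1) + n + 4"
proof -
  let ?w = "tower_word (Suc n) 1"
  let ?N = "num_rewrites \<sigma> ?w"
  have "\<not> reducible (last (run \<sigma> ?w ?N))"
    unfolding num_rewrites_def using run_terminates[OF assms] by (rule LeastI_ex)
  with run_tower_word[OF assms, of "Suc n" ?N]
  have "length (gpow Ga (int (tower (Suc n) 1))) \<le> 2 ^ ?N * length ?w"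
    using irreducible_reduct[of _ "Suc n" 1] by (metis mult_1)
  also have "\<dots> \<le> 2 ^ ?N * 2 ^ (n + 4)"
    by (intro mult_left_mono length_tower_word_Suc_le) simp
  finally have "(2::nat) ^ tower n 1 \<le> 2 ^ (?N + (n + 4))"
    by (simp add: power_add nat_power_eq del: tower_word.simps)
  then show ?thesis by simp
qed

section \<open>Growth of the tower function\<close>

lemma tower_add: "tower (k + j) n = tower k (tower j n)"
  by (induction k) auto

text \<open>Exponentiation does not shrink gaps between natural numbers. This moves an additive
  error into the argument and also yields monotonicity.\<close>

lemma tower_gap: "tower k x + d \<le> tower k (x + d)"
proof (induction k)
  case (Suc k)
  have "(2::nat) ^ y + d \<le> 2 ^ (y + d)" for y
  proof (induction d)
    case (Suc d)
    have "(1::nat) \<le> 2 ^ (y + d)" by (rule one_le_power) simp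
    with Suc show ?case unfolding add_Suc_right power_Suc by linarith
  qed simp
  also have "(2::nat) ^ (tower k x + d) \<le> 2 ^ tower k (x + d)"
    using Suc by (rule power_increasing) simp
  finally show ?case by simp
qed simp

lemma Suc_le_tower: "Suc k \<le> tower k 1"
proof (induction k)
  case (Suc k)
  also have "tower k 1 < tower (Suc k) 1" by simp
  finally show ?case by simp
qed simp

theorem theorem2p3:
  fixes \<sigma> :: strategy
  assumes "realization \<sigma>"
  shows "\<not> (\<exists>k. \<forall>n. time \<sigma> n \<le> tower k n)"
proof
  assume "\<exists>k. \<forall>n. time \<sigma> n \<le> tower k n"
  then obtain k where k: "\<And>n. time \<sigma> n \<le> tower k n" by blast
  \<comment> \<open>As \<open>tower n 1 = tower k (tower j 1)\<close>, it suffices to compare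
    arguments of \<open>tower k\<close>: \<open>tower j 1\<close> must reach
    \<open>2 ^ (n + 4) + (n + 5)\<close>, where \<open>n + 5 = 2 * k + 10\<close>. Two of the
    \<open>j\<close> exponentials over \<open>tower (k + 3) 1 \<ge> k + 4\<close> achieve
    this.\<close>
  define j where "j = k + 5"
  define n where "n = k + j"
  have "tower_word (Suc n) 1 \<in> input_words (2 ^ (n + 4))"
    using tower_word_letters length_tower_word_Suc_le
    by (simp add: input_words_def del: tower_word.simps)
  then have "num_rewrites \<sigma> (tower_word (Suc n) 1) \<le> time \<sigma> (2 ^ (n + 4))"
    unfolding time_def by (intro Max_ge finite_imageI finite_input_words imageI)
  with k[of "2 ^ (n + 4)"] num_rewrites_tower_word[OF assms, of n]
  have "tower k (tower j 1) \<le> tower k (2 ^ (n + 4)) + (n + 4)"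
    unfolding n_def tower_add by simp
  also have "\<dots> < tower k (2 ^ (n + 4)) + (n + 5)" by simp
  also have "\<dots> \<le> tower k (2 ^ (n + 4) + (n + 5))" by (rule tower_gap)
  also have "\<dots> \<le> tower k (tower j 1)"
  proof -
    have "n + 5 \<le> 2 ^ (n + 4)"
      using less_exp[of "n + 4"] by linarith
    then have "2 ^ (n + 4) + (n + 5) \<le> (2::nat) ^ (n + 5)" by (simp add: power_add)
    also have "n + 5 \<le> 2 ^ (k + 4)"
    proof -
      have "2 * k + 10 \<le> 2 ^ (k + 4)"
      proof -
        have "k < 2 ^ k" by (rule less_exp)
        moreover have "(2::nat) ^ (k + 4) = 16 * 2 ^ k" by (simp add: power_add)
        ultimately show ?thesis by linarith
      qed
      then show ?thesis by (simp add: n_def j_def)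
    qed
    then have "(2::nat) ^ (n + 5) \<le> 2 ^ 2 ^ (k + 4)" by (intro power_increasing) auto
    also have "\<dots> \<le> 2 ^ 2 ^ tower (k + 3) 1"
      using Suc_le_tower[of "k + 3"] by (intro power_increasing) auto
    also have "\<dots> = tower (Suc (Suc (k + 3))) 1" by (simp only: tower.simps)
    also have "Suc (Suc (k + 3)) = j" by (simp add: j_def)
    finally show ?thesis
      \<comment> \<open>Monotonicity of \<open>tower k\<close>, with the difference of the two
        arguments as the gap.\<close>
      using tower_gap[of k "2 ^ (n + 4) + (n + 5)" "tower j 1 - (2 ^ (n + 4) + (n + 5))"] by simp
  qed
  finally show False by simp
qed

end
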